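(* For every integer $n\ge1$, the hyperpolygonal arrangement $\mathcal{H}_n$ in $\mathbb{R}^n$ is combinatorially formal; that is, every hyperplane arrangement whose intersection lattice is isomorphic as a poset to $L(\mathcal{H}_n)$ is formal.
   Context: Let $x_1,\dots,x_n$ be the coordinate functions on $\mathbb{R}^n$. For $I\subseteq[n]$ put $H_I:=\ker\big(\sum_{i\in I}x_i-\sum_{j\in[n]\setminus I}x_j\big)$, and $\mathcal{H}_n:=\{\ker x_i\mid i\in[n]\}\cup\{H_I\mid\varnothing\ne I\subseteq[n]\}$. For a central arrangement $\mathcal{A}$ in a $\mathbb{K}$-vector space $V$ with chosen defining forms $\alpha_H\in V^*$ ($H=\ker\alpha_H$), consider the space of linear relations $F(\mathcal{A})=\ker\big(\mathbb{K}^{\mathcal{A}}\to V^*,\ e_H\mapsto\alpha_H\big)$. $\mathcal{A}$ is formal if $F(\mathcal{A})$ is spanned by relations supported on $\mathcal{A}_X=\{H\in\mathcal{A}:X\subseteq H\}$ for $X$ ranging over intersections of codimension $2$. The intersection lattice $L(\mathcal{A})$ is the set of intersections of subsets of $\mathcal{A}$ ordered by reverse inclusion. *)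

theory Defs
  imports "HOL-Analysis.Analysis" "HOL-Library.Function_Algebras"
begin

text \<open>
  The ambient vector space is the whole type \<open>'v\<close>, with an explicit scalar multiplication by
  an arbitrary field \<open>'k\<close>. Arrangements are finite and central; \<open>'v\<close> need not be finite-dimensional.
\<close>

definition defining_form ::
  "('k::field \<Rightarrow> 'v::ab_group_add \<Rightarrow> 'v) \<Rightarrow> 'v set \<Rightarrow> ('v \<Rightarrow> 'k) \<Rightarrow> bool" where
  "defining_form smul H \<alpha> \<longleftrightarrow>
     Vector_Spaces.linear smul (*) \<alpha> \<and> (\<exists>v. \<alpha> v \<noteq> 0) \<and> H = {v. \<alpha> v = 0}"

definition central_arrangement ::
  "('k::field \<Rightarrow> 'v::ab_group_add \<Rightarrow> 'v) \<Rightarrow> 'v set set \<Rightarrow> bool" where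
  "central_arrangement smul A \<longleftrightarrow> finite A \<and> (\<forall>H\<in>A. \<exists>\<alpha>. defining_form smul H \<alpha>)"

text \<open>The empty subfamily contributes the whole space, since \<open>\<Inter>{} = UNIV\<close>.\<close>

definition intersection_lattice :: "'v set set \<Rightarrow> 'v set set" where
  "intersection_lattice A = {\<Inter>B | B. B \<subseteq> A}"

definition lattice_isomorphic :: "'u set set \<Rightarrow> 'v set set \<Rightarrow> bool" where
  "lattice_isomorphic L M \<longleftrightarrow>
     (\<exists>\<phi>. bij_betw \<phi> L M \<and> (\<forall>X\<in>L. \<forall>Y\<in>L. X \<supseteq> Y \<longleftrightarrow> \<phi> X \<supseteq> \<phi> Y))"

text \<open>
  A subspace has codimension \<open>k\<close> if it has a complement with a basis of \<open>k\<close> vectors. Unlike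
  \<open>dim UNIV - dim X\<close>, this is meaningful in infinite dimension too.
\<close>

definition has_codim ::
  "('k::field \<Rightarrow> 'v::ab_group_add \<Rightarrow> 'v) \<Rightarrow> 'v set \<Rightarrow> nat \<Rightarrow> bool" where
  "has_codim smul X k \<longleftrightarrow>
     (\<exists>B. finite B \<and> card B = k \<and> \<not> module.dependent smul B \<and>
          X \<inter> module.span smul B = {0} \<and>
          {x + w | x w. x \<in> X \<and> w \<in> module.span smul B} = UNIV)"

text \<open>\<open>K\<^sup>A\<close> is encoded as the functions on all subsets of \<open>V\<close> that vanish outside \<open>A\<close>.\<close>

definition relation_space :: "'v set set \<Rightarrow> ('v set \<Rightarrow> 'v \<Rightarrow> 'k::field) \<Rightarrow> ('v set \<Rightarrow> 'k) set" where
  "relation_space A \<alpha> =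
     {c. (\<forall>H. H \<notin> A \<longrightarrow> c H = 0) \<and> (\<forall>v. (\<Sum>H\<in>A. c H * \<alpha> H v) = 0)}"

definition localization :: "'v set set \<Rightarrow> 'v set \<Rightarrow> 'v set set" where
  "localization A X = {H\<in>A. X \<subseteq> H}"

definition local_relations ::
  "('k::field \<Rightarrow> 'v::ab_group_add \<Rightarrow> 'v) \<Rightarrow> 'v set set \<Rightarrow> ('v set \<Rightarrow> 'v \<Rightarrow> 'k) \<Rightarrow> ('v set \<Rightarrow> 'k) set"
  where
  "local_relations smul A \<alpha> =
     {c \<in> relation_space A \<alpha>. \<exists>X\<in>intersection_lattice A.
        has_codim smul X 2 \<and> {H. c H \<noteq> 0} \<subseteq> localization A X}"

text \<open>
  Replacing \<open>\<alpha> H\<close> by another defining form of \<open>H\<close> rescales the coordinate at \<open>H\<close>, so the condition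
  does not depend on the choice of \<open>\<alpha>\<close>; it is required for every choice.
\<close>

definition formal_arrangement ::
  "('k::field \<Rightarrow> 'v::ab_group_add \<Rightarrow> 'v) \<Rightarrow> 'v set set \<Rightarrow> bool" where
  "formal_arrangement smul A \<longleftrightarrow>
     (\<forall>\<alpha>. (\<forall>H\<in>A. defining_form smul H (\<alpha> H)) \<longrightarrow>
        relation_space A \<alpha> = module.span (\<lambda>a c H. a * c H) (local_relations smul A \<alpha>))"

definition coordinate_hyperplane :: "'n::finite \<Rightarrow> (real ^ 'n) set" where
  "coordinate_hyperplane i = {x. x $ i = 0}"

definition signed_hyperplane :: "'n::finite set \<Rightarrow> (real ^ 'n) set" where
  "signed_hyperplane I = {x. (\<Sum>i\<in>I. x $ i) - (\<Sum>j\<in>UNIV - I. x $ j) = 0}"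

definition hyperpolygonal :: "(real ^ 'n::finite) set set" where
  "hyperpolygonal = range coordinate_hyperplane \<union> {signed_hyperplane I | I. I \<noteq> {}}"

lemma central_arrangement_hyperpolygonal:
  "central_arrangement (*\<^sub>R) (hyperpolygonal :: (real ^ 'n::finite) set set)"
proof -
  have "finite (hyperpolygonal :: (real ^ 'n) set set)"
  proof -
    have "(hyperpolygonal :: (real ^ 'n) set set)
        \<subseteq> range coordinate_hyperplane \<union> range signed_hyperplane"
      by (auto simp: hyperpolygonal_def)
    then show ?thesis by (rule finite_subset) simp
  qed
  moreover have "\<exists>\<alpha>. defining_form (*\<^sub>R) (coordinate_hyperplane i) \<alpha>" for i :: 'n
  proof -
    have "Vector_Spaces.linear (*\<^sub>R) (*) (\<lambda>x::real^'n. x $ i)"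
      by unfold_locales (auto simp: algebra_simps)
    moreover have "axis i 1 $ i \<noteq> (0::real)" by simp
    ultimately show ?thesis
      unfolding defining_form_def coordinate_hyperplane_def by blast
  qed
  moreover have "\<exists>\<alpha>. defining_form (*\<^sub>R) (signed_hyperplane I) \<alpha>"
    if I: "I \<noteq> {}" for I :: "'n set"
  proof -
    let ?f = "\<lambda>x::real^'n. (\<Sum>i\<in>I. x $ i) - (\<Sum>j\<in>UNIV - I. x $ j)"
    obtain i where i: "i \<in> I" using I by blast
    have "Vector_Spaces.linear (*\<^sub>R) (*) ?f"
      by unfold_locales (auto simp: algebra_simps sum.distrib sum_distrib_left)
    moreover have "?f (axis i 1) = 1"
      using i by (simp add: axis_def)
    then have "\<exists>v. ?f v \<noteq> 0" by (metis zero_neq_one)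
    ultimately show ?thesis
      unfolding defining_form_def signed_hyperplane_def by blast
  qed
  ultimately show ?thesis
    unfolding central_arrangement_def hyperpolygonal_def by auto
qed

lemma (in finite_dimensional_vector_space) has_codim_iff_dim:
  assumes X: "subspace X"
  shows "has_codim scale X k \<longleftrightarrow> dim X + k = dim UNIV"
proof
  assume "has_codim scale X k"
  then obtain B where B: "card B = k" "independent B" "X \<inter> span B = {0}"
    "{x + w | x w. x \<in> X \<and> w \<in> span B} = UNIV"
    unfolding has_codim_def by blast
  have "dim {x + w | x w. x \<in> X \<and> w \<in> span B} + dim (X \<inter> span B) = dim X + dim (span B)"
    by (rule dim_sums_Int[OF X subspace_span])
  then show "dim X + k = dim UNIV"
    using B by (simp add: dim_eq_card_independent)
next
  assume k: "dim X + k = dim UNIV"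
  obtain C where C: "C \<subseteq> X" "independent C" "X \<subseteq> span C" "card C = dim X"
    by (rule basis_exists)
  obtain D where D: "C \<subseteq> D" "independent D" "UNIV \<subseteq> span D"
    by (rule maximal_independent_subset_extend[OF subset_UNIV C(2)])
  have spanC: "span C = X" using C X by (metis span_minimal subset_antisym)
  have finD: "finite D" using D(2) by (rule finiteI_independent)
  have B1: "card (D - C) = k"
  proof -
    have "span D = UNIV" using D(3) by blast
    then have "card D = dim UNIV" using dim_eq_card[of D UNIV] D(2) by simp
    moreover have "card (D - C) = card D - card C"
      using D(1) finD by (meson card_Diff_subset finite_subset)
    ultimately show ?thesis using k C(4) by simp
  qed
  have B2: "independent (D - C)" using D(2) by (rule independent_mono) blast
  have sums: "{x + w | x w. x \<in> X \<and> w \<in> span (D - C)} = UNIV"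
  proof -
    have "span (C \<union> (D - C)) = UNIV" using D(1,3) by (simp add: Un_absorb1 top.extremum_unique)
    then show ?thesis unfolding span_Un spanC by blast
  qed
  have "dim {x + w | x w. x \<in> X \<and> w \<in> span (D - C)} + dim (X \<inter> span (D - C))
      = dim X + dim (span (D - C))"
    by (rule dim_sums_Int[OF X subspace_span])
  then have "dim (X \<inter> span (D - C)) = 0"
    using sums k B1 B2 by (simp add: dim_eq_card_independent)
  moreover have "0 \<in> X \<inter> span (D - C)" using X by (simp add: subspace_0 span_zero)
  ultimately have "X \<inter> span (D - C) = {0}" by (auto simp: dim_eq_0)
  then show "has_codim scale X k"
    unfolding has_codim_def using B1 B2 sums finD by (intro exI[of _ "D - C"]) simp
qed

end

theory Submission
  imports Defs
begin

text \<open>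
  Call a set of hyperplanes line-closed if it contains every member of the arrangement through the
  intersection of two of its distinct elements. Such a hyperplane is obtained from a relation of
  codimension \<open>2\<close>, so if an independent family \<open>B\<close> has line closure \<open>A\<close>, every relation on \<open>A\<close>
  is congruent, modulo relations of codimension \<open>2\<close>, to one supported on \<open>B\<close>, which must vanish.
  The existence of such a \<open>B\<close> depends only on the intersection lattice.

  For the hyperpolygonal arrangement fix a coordinate \<open>z\<close> and let \<open>B\<close> consist of \<open>H\<^bsub>[n]\<^esub>\<close> and
  the \<open>ker x\<^sub>i\<close> with \<open>i \<noteq> z\<close>. Since \<open>H\<^bsub>I\<^esub>\<close>, \<open>H\<^bsub>I - {i}\<^esub>\<close> and \<open>ker x\<^sub>i\<close> share a
  codimension \<open>2\<close> subspace, the closure contains every \<open>H\<^bsub>I\<^esub>\<close> with \<open>z \<in> I\<close>, hence all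
  \<open>H\<^bsub>I\<^esub>\<close> because \<open>H\<^bsub>I\<^esub> = H\<^bsub>[n] - I\<^esub>\<close>, and finally \<open>ker x\<^sub>z\<close> from \<open>H\<^bsub>[n]\<^esub>\<close> and \<open>H\<^bsub>{z}\<^esub>\<close>.
\<close>

section \<open>Line closure and line generation\<close>

inductive_set line_closure :: "'v set set \<Rightarrow> 'v set set \<Rightarrow> 'v set set"
  for A B :: "'v set set" where
  base: "H \<in> B \<Longrightarrow> H \<in> line_closure A B"
| step: "\<lbrakk>G \<in> line_closure A B; H \<in> line_closure A B; G \<noteq> H; K \<in> A; G \<inter> H \<subseteq> K\<rbrakk>
    \<Longrightarrow> K \<in> line_closure A B"

lemma line_closure_subset:
  assumes "B \<subseteq> A"
  shows "line_closure A B \<subseteq> A"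
proof
  fix H assume "H \<in> line_closure A B"
  then show "H \<in> A" using assms by induction auto
qed

text \<open>For a finite family of hyperplanes this is linear independence of the defining forms,
  phrased through inclusions of intersections so that it passes along lattice isomorphisms.\<close>

definition lattice_independent :: "'v set set \<Rightarrow> bool" where
  "lattice_independent B \<longleftrightarrow> (\<forall>H\<in>B. \<not> \<Inter>(B - {H}) \<subseteq> H)"

definition line_generated :: "'v set set \<Rightarrow> bool" where
  "line_generated A \<longleftrightarrow> (\<exists>B\<subseteq>A. lattice_independent B \<and> A \<subseteq> line_closure A B)"

section \<open>Linear forms\<close>

lemma linear_form:
  assumes "Vector_Spaces.linear smul (*) \<alpha>"
  shows linear_form_add: "\<alpha> (x + y) = \<alpha> x + \<alpha> y"
    and linear_form_diff: "\<alpha> (x - y) = \<alpha> x - \<alpha> y"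
    and linear_form_scale: "\<alpha> (smul a x) = a * \<alpha> x"
proof -
  interpret Vector_Spaces.linear smul "(*)" \<alpha> by fact
  show "\<alpha> (x + y) = \<alpha> x + \<alpha> y" "\<alpha> (x - y) = \<alpha> x - \<alpha> y" "\<alpha> (smul a x) = a * \<alpha> x"
    by (rule add diff scale)+
qed

text \<open>A form \<open>\<beta>\<close> vanishing on the kernel of \<open>\<alpha>\<close> is a
  scalar multiple of \<open>\<alpha>\<close>, and the scalar is nonzero because
  \<open>\<beta>\<close> is.\<close>

lemma hyperplane_subset_imp_eq:
  assumes H: "defining_form smul H \<alpha>" and G: "defining_form smul G \<beta>" and "H \<subseteq> G"
  shows "H = G"
proof -
  have lin: "Vector_Spaces.linear smul (*) \<alpha>" "Vector_Spaces.linear smul (*) \<beta>"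
    and HG: "H = {v. \<alpha> v = 0}" "G = {v. \<beta> v = 0}"
    using H G by (auto simp: defining_form_def)
  obtain v u where v: "\<alpha> v \<noteq> 0" and u: "\<beta> u \<noteq> 0"
    using H G unfolding defining_form_def by blast
  have \<beta>: "\<beta> w = \<alpha> w / \<alpha> v * \<beta> v" for w
  proof -
    have "w - smul (\<alpha> w / \<alpha> v) v \<in> H"
      using v by (simp add: HG linear_form[OF lin(1)])
    then have "\<beta> (w - smul (\<alpha> w / \<alpha> v) v) = 0" using \<open>H \<subseteq> G\<close> HG by blast
    then show ?thesis by (simp add: linear_form[OF lin(2)])
  qed
  have "\<beta> v \<noteq> 0" using u \<beta>[of u] by auto
  then have "\<alpha> w = 0" if "\<beta> w = 0" for w
    using \<beta>[of w] that v by auto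
  then show ?thesis using \<open>H \<subseteq> G\<close> HG by auto
qed

lemma defining_form_neq_UNIV: "defining_form smul H \<alpha> \<Longrightarrow> H \<noteq> UNIV"
  by (auto simp: defining_form_def)

text \<open>Distinct hyperplanes are incomparable, so each contains a vector outside the other;
  rescaling gives a pair dual to the two forms.\<close>

lemma dual_vectors:
  assumes H: "defining_form smul H \<alpha>" and G: "defining_form smul G \<beta>" and "H \<noteq> G"
  obtains u v where "\<alpha> u = 1" "\<beta> u = 0" "\<alpha> v = 0" "\<beta> v = 1"
proof -
  have lin: "Vector_Spaces.linear smul (*) \<alpha>" "Vector_Spaces.linear smul (*) \<beta>"
    and HG: "H = {v. \<alpha> v = 0}" "G = {v. \<beta> v = 0}"
    using H G by (auto simp: defining_form_def)
  have "\<not> H \<subseteq> G" "\<not> G \<subseteq> H"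
    using hyperplane_subset_imp_eq H G \<open>H \<noteq> G\<close> by metis+
  then obtain u v where "\<alpha> u \<noteq> 0" "\<beta> u = 0" "\<alpha> v = 0" "\<beta> v \<noteq> 0"
    using HG by blast
  then show thesis
    by (intro that[of "smul (1 / \<alpha> u) u" "smul (1 / \<beta> v) v"])
       (simp_all add: linear_form[OF lin(1)] linear_form[OF lin(2)])
qed

text \<open>The dual vectors \<open>u\<close>, \<open>v\<close> form a basis of a complement of
  \<open>H \<inter> G\<close>.\<close>

lemma has_codim_2_Int:
  assumes "vector_space smul"
    and H: "defining_form smul H \<alpha>" and G: "defining_form smul G \<beta>" and "H \<noteq> G"
  shows "has_codim smul (H \<inter> G) 2"
proof -
  interpret vector_space smul by fact
  have lin: "Vector_Spaces.linear smul (*) \<alpha>" "Vector_Spaces.linear smul (*) \<beta>"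
    and HG: "H = {v. \<alpha> v = 0}" "G = {v. \<beta> v = 0}"
    using H G by (auto simp: defining_form_def)
  note lf = linear_form[OF lin(1)] linear_form[OF lin(2)]
  have zero: "\<alpha> 0 = 0" "\<beta> 0 = 0"
    using lf(3)[of 0 0] lf(6)[of 0 0] by simp_all
  obtain u v where uv: "\<alpha> u = 1" "\<beta> u = 0" "\<alpha> v = 0" "\<beta> v = 1"
    using dual_vectors[OF H G \<open>H \<noteq> G\<close>] .
  have span: "span {u, v} = {smul a u + smul b v | a b. True}"
    by (auto simp: span_insert span_singleton algebra_simps)
  have "u \<noteq> v" using uv by auto
  have "u \<notin> span {v}" "v \<noteq> 0"
    using uv zero by (auto simp: span_singleton lf)
  then have "independent {u, v}"
    using \<open>u \<noteq> v\<close> by (simp add: independent_insert)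
  moreover have "H \<inter> G \<inter> span {u, v} = {0}"
    using uv zero by (auto simp: span HG lf) (metis scale_zero_left add_0)
  moreover have "{x + w | x w. x \<in> H \<inter> G \<and> w \<in> span {u, v}} = UNIV"
  proof -
    have "\<exists>y w. x = y + w \<and> y \<in> H \<inter> G \<and> w \<in> span {u, v}" for x
    proof (intro exI conjI)
      \<comment> \<open>The projection of \<open>x\<close> to \<open>span {u, v}\<close> along
        \<open>H \<inter> G\<close>.\<close>
      let ?w = "smul (\<alpha> x) u + smul (\<beta> x) v"
      show "x = (x - ?w) + ?w" by simp
      show "x - ?w \<in> H \<inter> G" using uv by (simp add: HG lf)
      show "?w \<in> span {u, v}" unfolding span by blast
    qed
    then show ?thesis by blast
  qed
  ultimately show ?thesis
    unfolding has_codim_def using \<open>u \<noteq> v\<close> by (intro exI[of _ "{u, v}"]) simp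
qed

text \<open>Removing from \<open>x\<close> its component along the dual vectors leaves a point of
  \<open>H \<inter> G\<close>, where \<open>\<gamma>\<close> vanishes; the coefficients are thus
  \<open>\<gamma> u\<close> and \<open>\<gamma> v\<close>.\<close>

lemma form_eq_combination:
  assumes H: "defining_form smul H \<alpha>" and G: "defining_form smul G \<beta>" and "H \<noteq> G"
    and K: "defining_form smul K \<gamma>" and "H \<inter> G \<subseteq> K"
  obtains a b where "\<And>x. \<gamma> x = a * \<alpha> x + b * \<beta> x"
proof -
  have lin: "Vector_Spaces.linear smul (*) \<alpha>" "Vector_Spaces.linear smul (*) \<beta>"
      "Vector_Spaces.linear smul (*) \<gamma>"
    and HG: "H = {v. \<alpha> v = 0}" "G = {v. \<beta> v = 0}" "K = {v. \<gamma> v = 0}"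
    using H G K by (auto simp: defining_form_def)
  note lf = linear_form[OF lin(1)] linear_form[OF lin(2)] linear_form[OF lin(3)]
  obtain u v where uv: "\<alpha> u = 1" "\<beta> u = 0" "\<alpha> v = 0" "\<beta> v = 1"
    using dual_vectors[OF H G \<open>H \<noteq> G\<close>] .
  have "\<gamma> x = \<gamma> u * \<alpha> x + \<gamma> v * \<beta> x" for x
  proof -
    have "x - (smul (\<alpha> x) u + smul (\<beta> x) v) \<in> H \<inter> G"
      using uv by (simp add: HG lf)
    then have "\<gamma> (x - (smul (\<alpha> x) u + smul (\<beta> x) v)) = 0"
      using \<open>H \<inter> G \<subseteq> K\<close> HG by blast
    then show ?thesis by (simp add: lf mult.commute)
  qed
  then show thesis by (rule that)
qed

section \<open>Line-generated arrangements are formal\<close>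

lemma vector_space_pointwise: "vector_space (\<lambda>(a::'k::field) (c::'i \<Rightarrow> 'k) H. a * c H)"
  by unfold_locales (auto simp: fun_eq_iff algebra_simps)

text \<open>At a point common to all members of \<open>B\<close> except \<open>H\<close>, only the
  term of \<open>H\<close> can survive in the relation. If its coefficient were nonzero, the point
  would lie in \<open>H\<close>, against independence.\<close>

lemma relation_supported_on_independent_eq_0:
  fixes \<alpha> :: "'v set \<Rightarrow> 'v::ab_group_add \<Rightarrow> 'k::field"
  assumes "finite A" and forms: "\<forall>H\<in>A. defining_form smul H (\<alpha> H)"
    and "B \<subseteq> A" and B: "lattice_independent B"
    and d: "d \<in> relation_space A \<alpha>" and supp: "\<And>H. H \<notin> B \<Longrightarrow> d H = 0"
  shows "d = 0"
proof
  fix H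
  show "d H = 0 H"
  proof (rule ccontr)
    assume "d H \<noteq> 0 H"
    then have dH: "d H \<noteq> 0" by simp
    then have "H \<in> B" using supp by blast
    have ker: "G = {v. \<alpha> G v = 0}" if "G \<in> A" for G
      using forms that by (auto simp: defining_form_def)
    have "x \<in> H" if x: "x \<in> \<Inter>(B - {H})" for x
    proof -
      have "d G * \<alpha> G x = 0" if "G \<in> A - {H}" for G
        using that x supp[of G] ker[of G] by (cases "G \<in> B") auto
      then have "(\<Sum>G\<in>A - {H}. d G * \<alpha> G x) = 0" by (rule sum.neutral[OF ballI])
      then have "(\<Sum>G\<in>A. d G * \<alpha> G x) = d H * \<alpha> H x"
        using \<open>finite A\<close> \<open>H \<in> B\<close> \<open>B \<subseteq> A\<close> by (subst sum.remove[of A H]) auto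
      then have "d H * \<alpha> H x = 0" using d by (simp add: relation_space_def)
      then show ?thesis using dH ker[of H] \<open>H \<in> B\<close> \<open>B \<subseteq> A\<close> by auto
    qed
    then show False using B \<open>H \<in> B\<close> unfolding lattice_independent_def by blast
  qed
qed

theorem formal_if_line_generated:
  fixes smul :: "'k::field \<Rightarrow> 'v::ab_group_add \<Rightarrow> 'v"
  assumes vs: "vector_space smul" and arr: "central_arrangement smul A"
    and gen: "line_generated A"
  shows "formal_arrangement smul A"
  unfolding formal_arrangement_def
proof (intro allI impI)
  fix \<alpha> :: "'v set \<Rightarrow> 'v \<Rightarrow> 'k"
  assume forms: "\<forall>H\<in>A. defining_form smul H (\<alpha> H)"
  interpret P: vector_space "\<lambda>(a::'k) (c::'v set \<Rightarrow> 'k) H. a * c H"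
    by (rule vector_space_pointwise)
  have finA: "finite A" using arr by (simp add: central_arrangement_def)
  obtain B where BA: "B \<subseteq> A" and B: "lattice_independent B" and clos: "A \<subseteq> line_closure A B"
    using gen unfolding line_generated_def by blast
  let ?S = "P.span (local_relations smul A \<alpha>)"
  \<comment> \<open>The vectors congruent modulo \<open>?S\<close> to one supported on
    \<open>B\<close>. They need not be relations, so unit vectors qualify, and it suffices to show
    that all of these lie in \<open>T\<close>.\<close>
  define T where "T = {c. \<exists>d. (\<forall>H. H \<notin> B \<longrightarrow> d H = 0) \<and> c - d \<in> ?S}"
  have "P.subspace (relation_space A \<alpha>)"
    by (auto simp: P.subspace_def relation_space_def algebra_simps sum.distrib
        simp flip: sum_distrib_left)
  then have SR: "?S \<subseteq> relation_space A \<alpha>"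
    by (intro P.span_minimal) (auto simp: local_relations_def)
  have T: "P.subspace T"
  proof (rule P.subspaceI)
    show "0 \<in> T" unfolding T_def by (auto intro!: exI[of _ 0] P.span_zero)
  next
    fix x y assume "x \<in> T" "y \<in> T"
    then obtain d e where "\<forall>H. H \<notin> B \<longrightarrow> d H = 0" "x - d \<in> ?S"
        "\<forall>H. H \<notin> B \<longrightarrow> e H = 0" "y - e \<in> ?S"
      unfolding T_def by blast
    moreover from this have "(x - d) + (y - e) \<in> ?S" by (intro P.span_add)
    then have "x + y - (d + e) \<in> ?S" by (simp add: add_diff_add)
    ultimately show "x + y \<in> T" unfolding T_def
      by (auto intro!: exI[of _ "d + e"])
  next
    fix a x assume "x \<in> T"
    then obtain d where d: "\<forall>H. H \<notin> B \<longrightarrow> d H = 0" "x - d \<in> ?S"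
      unfolding T_def by blast
    have "(\<lambda>H. a * x H) - (\<lambda>H. a * d H) = (\<lambda>H. a * (x - d) H)"
      by (auto simp: algebra_simps)
    then have "(\<lambda>H. a * x H) - (\<lambda>H. a * d H) \<in> ?S"
      using P.span_scale[OF d(2), of a] by simp
    then show "(\<lambda>H. a * x H) \<in> T" unfolding T_def
      using d(1) by (auto intro!: exI[of _ "\<lambda>H. a * d H"])
  qed
  have ST: "?S \<subseteq> T"
    unfolding T_def by (auto intro!: exI[of _ 0])
  define \<delta> :: "'v set \<Rightarrow> 'v set \<Rightarrow> 'k" where "\<delta> H = (\<lambda>G. if G = H then 1 else 0)" for H
  have \<delta>T: "\<delta> H \<in> T" if "H \<in> line_closure A B" for H
    using that
  proof induction
    case (base H)
    then show ?case unfolding T_def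
      by (auto simp: \<delta>_def P.span_zero intro!: exI[of _ "\<delta> H"])
  next
    case (step G H K)
    have GH: "G \<in> A" "H \<in> A" using step line_closure_subset[OF BA] by auto
    obtain a b where ab: "\<And>x. \<alpha> K x = a * \<alpha> G x + b * \<alpha> H x"
      using form_eq_combination[of smul G "\<alpha> G" H "\<alpha> H" K "\<alpha> K"] forms GH step by blast
    \<comment> \<open>The dependency of \<open>\<alpha> K\<close> on \<open>\<alpha> G\<close> and
      \<open>\<alpha> H\<close> as a relation: its support lies in \<open>{G, H, K}\<close>, all of
      which contain the codimension 2 space \<open>G \<inter> H\<close>.\<close>
    define r where "r = \<delta> K - ((\<lambda>X. a * \<delta> G X) + (\<lambda>X. b * \<delta> H X))"
    have sum_\<delta>: "(\<Sum>Y\<in>A. c * \<delta> X Y * \<alpha> Y v) = c * \<alpha> X v" if "X \<in> A" for X c v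
    proof -
      have "(\<Sum>Y\<in>A. c * \<delta> X Y * \<alpha> Y v) = (\<Sum>Y\<in>A. if Y = X then c * \<alpha> X v else 0)"
        by (rule sum.cong) (auto simp: \<delta>_def)
      then show ?thesis using finA that by simp
    qed
    have "r \<in> relation_space A \<alpha>"
      unfolding relation_space_def
    proof (intro CollectI conjI allI impI)
      show "r X = 0" if "X \<notin> A" for X
        using that GH \<open>K \<in> A\<close> by (auto simp: r_def \<delta>_def)
      fix v
      have "(\<Sum>X\<in>A. r X * \<alpha> X v) = (\<Sum>X\<in>A. 1 * \<delta> K X * \<alpha> X v)
          - ((\<Sum>X\<in>A. a * \<delta> G X * \<alpha> X v) + (\<Sum>X\<in>A. b * \<delta> H X * \<alpha> X v))"
        by (simp add: r_def algebra_simps sum.distrib sum_subtractf)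
      then show "(\<Sum>X\<in>A. r X * \<alpha> X v) = 0"
        unfolding sum_\<delta>[OF GH(1)] sum_\<delta>[OF GH(2)] sum_\<delta>[OF \<open>K \<in> A\<close>] by (simp add: ab)
    qed
    moreover have "G \<inter> H \<in> intersection_lattice A"
      unfolding intersection_lattice_def using GH by (auto intro!: exI[of _ "{G, H}"])
    moreover have "has_codim smul (G \<inter> H) 2"
      using has_codim_2_Int[OF vs, of G "\<alpha> G" H "\<alpha> H"] forms GH \<open>G \<noteq> H\<close> by blast
    moreover have "{X. r X \<noteq> 0} \<subseteq> localization A (G \<inter> H)"
      using GH step by (auto simp: r_def \<delta>_def localization_def split: if_splits)
    ultimately have "r \<in> local_relations smul A \<alpha>"
      unfolding local_relations_def by blast
    then have "r \<in> T" using ST P.span_base by blast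
    moreover have "(\<lambda>X. a * \<delta> G X) + (\<lambda>X. b * \<delta> H X) \<in> T"
      using step.IH T by (intro P.subspace_add P.subspace_scale)
    moreover have "\<delta> K = r + ((\<lambda>X. a * \<delta> G X) + (\<lambda>X. b * \<delta> H X))"
      by (simp add: r_def)
    ultimately show ?case using P.subspace_add[OF T] by metis
  qed
  have "relation_space A \<alpha> \<subseteq> ?S"
  proof
    fix c assume c: "c \<in> relation_space A \<alpha>"
    have expand: "c G = (\<Sum>H\<in>A. c H * \<delta> H G)" for G
      using c finA by (auto simp: \<delta>_def relation_space_def if_distrib cong: if_cong)
    have pointwise: "(\<Sum>H\<in>A. (\<lambda>G. c H * \<delta> H G)) G = (\<Sum>H\<in>A. c H * \<delta> H G)" for G
      using finA by (induction A rule: finite_induct) auto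
    have "c = (\<Sum>H\<in>A. (\<lambda>G. c H * \<delta> H G))"
      by (rule ext) (rule trans[OF expand pointwise[symmetric]])
    also have "\<dots> \<in> T"
      using clos \<delta>T by (intro P.subspace_sum[OF T] P.subspace_scale[OF T]) blast
    finally obtain d where d: "\<forall>H. H \<notin> B \<longrightarrow> d H = 0" "c - d \<in> ?S"
      unfolding T_def by blast
    \<comment> \<open>This difference is \<open>d\<close>, which is therefore a relation supported
      on the independent set \<open>B\<close>.\<close>
    have "c - (c - d) \<in> relation_space A \<alpha>"
      using P.subspace_diff[OF \<open>P.subspace (relation_space A \<alpha>)\<close> c] d(2) SR by blast
    then have "d = 0"
      using relation_supported_on_independent_eq_0[OF finA forms BA B] d(1) by auto
    then show "c \<in> ?S" using d(2) by simp
  qed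
  then show "relation_space A \<alpha> = ?S" using SR by blast
qed

section \<open>Line generation is a lattice invariant\<close>

text \<open>Hyperplanes are the atoms under reverse inclusion, with bottom \<open>UNIV\<close>. This
  order-theoretic description lets an isomorphism recognize them.\<close>

lemma intersection_lattice_hyperplanes:
  assumes "central_arrangement smul A"
  shows "H \<in> A \<longleftrightarrow> H \<in> intersection_lattice A \<and> H \<noteq> UNIV \<and>
    (\<forall>X\<in>intersection_lattice A. H \<subseteq> X \<longrightarrow> X = H \<or> X = UNIV)"
proof (intro iffI conjI ballI impI; (elim conjE)?)
  assume H: "H \<in> A"
  then show "H \<in> intersection_lattice A"
    unfolding intersection_lattice_def by (auto intro!: exI[of _ "{H}"])
  show "H \<noteq> UNIV"
    using H assms defining_form_neq_UNIV unfolding central_arrangement_def by blast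
  fix X assume "X \<in> intersection_lattice A" "H \<subseteq> X"
  then obtain B where B: "B \<subseteq> A" "X = \<Inter>B" unfolding intersection_lattice_def by blast
  have "G = H" if "G \<in> B" for G
    using assms hyperplane_subset_imp_eq[of smul H _ G] H B \<open>H \<subseteq> X\<close> that
    unfolding central_arrangement_def by blast
  then have "B \<subseteq> {H}" by blast
  then show "X = H \<or> X = UNIV" using B by (auto simp: subset_singleton_iff)
next
  assume *: "H \<in> intersection_lattice A" "H \<noteq> UNIV"
    "\<forall>X\<in>intersection_lattice A. H \<subseteq> X \<longrightarrow> X = H \<or> X = UNIV"
  then obtain B where B: "B \<subseteq> A" "H = \<Inter>B" unfolding intersection_lattice_def by blast
  \<comment> \<open>\<open>B\<close> is nonempty, since \<open>\<Inter>{} = UNIV\<close>.\<close>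
  then obtain G where G: "G \<in> B" using * by fastforce
  then have "G \<in> A" "H \<subseteq> G" using B by auto
  moreover from this have "G \<in> intersection_lattice A"
    unfolding intersection_lattice_def by (auto intro!: exI[of _ "{G}"])
  moreover have "G \<noteq> UNIV"
    using \<open>G \<in> A\<close> assms defining_form_neq_UNIV unfolding central_arrangement_def by blast
  ultimately show "H \<in> A" using * by blast
qed

lemma lattice_isomorphic_sym:
  assumes "lattice_isomorphic L M"
  shows "lattice_isomorphic M L"
proof -
  obtain \<phi> where \<phi>: "bij_betw \<phi> L M" "\<forall>X\<in>L. \<forall>Y\<in>L. X \<supseteq> Y \<longleftrightarrow> \<phi> X \<supseteq> \<phi> Y"
    using assms unfolding lattice_isomorphic_def by blast
  let ?\<psi> = "inv_into L \<phi>"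
  have "bij_betw ?\<psi> M L" using \<phi>(1) by (rule bij_betw_inv_into)
  moreover have "?\<psi> X \<in> L" "\<phi> (?\<psi> X) = X" if "X \<in> M" for X
    using that \<phi>(1) by (auto simp: bij_betw_def inv_into_into f_inv_into_f)
  ultimately show ?thesis
    unfolding lattice_isomorphic_def using \<phi>(2) by (metis (no_types, lifting))
qed

text \<open>An isomorphism preserves \<open>UNIV\<close>, hence atoms, and intersections of
  hyperplanes; independence and line closure are expressed in these terms. The two arrangements may
  live over different fields.\<close>

theorem line_generated_lattice_invariant:
  assumes A: "central_arrangement smul A" and M: "central_arrangement smul' M"
    and iso: "lattice_isomorphic (intersection_lattice M) (intersection_lattice A)"
    and gen: "line_generated M"
  shows "line_generated A"
proof -
  let ?L = "intersection_lattice M" and ?L' = "intersection_lattice A"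
  obtain \<phi> where bij: "bij_betw \<phi> ?L ?L'"
    and ord': "\<forall>X\<in>?L. \<forall>Y\<in>?L. X \<supseteq> Y \<longleftrightarrow> \<phi> X \<supseteq> \<phi> Y"
    using iso unfolding lattice_isomorphic_def by blast
  have ord: "\<phi> X \<subseteq> \<phi> Y \<longleftrightarrow> X \<subseteq> Y" if "X \<in> ?L" "Y \<in> ?L" for X Y
    using ord' that by simp
  have \<phi>L: "\<phi> X \<in> ?L'" if "X \<in> ?L" for X using bij that by (auto simp: bij_betw_def)
  have inj: "\<phi> X = \<phi> Y \<longleftrightarrow> X = Y" if "X \<in> ?L" "Y \<in> ?L" for X Y
    using bij that by (auto simp: bij_betw_def inj_on_def)
  have surj: "\<exists>X\<in>?L. Y = \<phi> X" if "Y \<in> ?L'" for Y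
    using bij that by (auto simp: bij_betw_def)
  have Inter: "\<Inter>B \<in> ?L" if "B \<subseteq> M" for B
    using that unfolding intersection_lattice_def by blast
  have Inter': "\<Inter>B \<in> ?L'" if "B \<subseteq> A" for B
    using that unfolding intersection_lattice_def by blast
  have hyp_L: "H \<in> ?L" if "H \<in> M" for H using Inter[of "{H}"] that by simp
  have UNIV: "UNIV \<in> ?L" "UNIV \<in> ?L'" using Inter[of "{}"] Inter'[of "{}"] by simp_all
  have \<phi>UNIV: "\<phi> UNIV = UNIV"
    using surj[OF UNIV(2)] ord UNIV(1) by (metis subset_UNIV top.extremum_uniqueI)
  have \<phi>M: "\<phi> H \<in> A \<longleftrightarrow> H \<in> M" if "H \<in> ?L" for H
  proof -
    have "(\<forall>X\<in>?L'. \<phi> H \<subseteq> X \<longrightarrow> X = \<phi> H \<or> X = UNIV)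
        \<longleftrightarrow> (\<forall>X\<in>?L. H \<subseteq> X \<longrightarrow> X = H \<or> X = UNIV)"
      (is "?lhs \<longleftrightarrow> ?rhs")
    proof
      assume l: ?lhs
      show ?rhs
      proof (intro ballI impI)
        fix X assume X: "X \<in> ?L" "H \<subseteq> X"
        then have "\<phi> X = \<phi> H \<or> \<phi> X = \<phi> UNIV" using l \<phi>L ord that \<phi>UNIV by simp
        then show "X = H \<or> X = UNIV" using inj X that UNIV by simp
      qed
    next
      assume r: ?rhs
      show ?lhs
      proof (intro ballI impI)
        fix Y assume "Y \<in> ?L'" "\<phi> H \<subseteq> Y"
        moreover from this obtain X where "X \<in> ?L" "Y = \<phi> X" using surj by blast
        ultimately have "X \<in> ?L" "Y = \<phi> X" "H \<subseteq> X" using ord that by simp_all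
        then show "Y = \<phi> H \<or> Y = UNIV" using r \<phi>UNIV by auto
      qed
    qed
    moreover have "\<phi> H \<noteq> UNIV \<longleftrightarrow> H \<noteq> UNIV"
      using inj that UNIV \<phi>UNIV by metis
    ultimately show ?thesis
      using that \<phi>L[OF that] intersection_lattice_hyperplanes[OF A, of "\<phi> H"]
        intersection_lattice_hyperplanes[OF M, of H] by argo
  qed
  have image: "\<phi> ` M = A"
  proof
    show "\<phi> ` M \<subseteq> A" using \<phi>M hyp_L by blast
    show "A \<subseteq> \<phi> ` M"
    proof
      fix H assume "H \<in> A"
      then show "H \<in> \<phi> ` M" using surj[of H] Inter'[of "{H}"] \<phi>M by auto
    qed
  qed
  have \<phi>Inter: "\<phi> (\<Inter>C) = \<Inter>(\<phi> ` C)" if C: "C \<subseteq> M" for C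
  proof
    show "\<phi> (\<Inter>C) \<subseteq> \<Inter>(\<phi> ` C)"
      using ord[OF Inter[OF C]] hyp_L C by (auto simp: Inter_lower subset_iff)
    have "\<Inter>(\<phi> ` C) \<in> ?L'" using C image by (intro Inter') blast
    then obtain X where X: "X \<in> ?L" "\<Inter>(\<phi> ` C) = \<phi> X" using surj by blast
    have "X \<subseteq> H" if "H \<in> C" for H
      using ord[OF X(1) hyp_L[of H]] X(2) that C by blast
    then have "X \<subseteq> \<Inter>C" by blast
    then show "\<Inter>(\<phi> ` C) \<subseteq> \<phi> (\<Inter>C)"
      using X ord[OF X(1) Inter[OF C]] by simp
  qed
  have transfer: "\<Inter>(\<phi> ` C) \<subseteq> \<phi> H \<longleftrightarrow> \<Inter>C \<subseteq> H" if "C \<subseteq> M" "H \<in> M" for C H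
    using \<phi>Inter[OF that(1)] ord[OF Inter[OF that(1)] hyp_L[OF that(2)]] by simp
  obtain B where BM: "B \<subseteq> M" and B: "lattice_independent B" and clos: "M \<subseteq> line_closure M B"
    using gen unfolding line_generated_def by blast
  have "lattice_independent (\<phi> ` B)"
    unfolding lattice_independent_def
  proof (rule ballI)
    fix K assume "K \<in> \<phi> ` B"
    then obtain H where H: "H \<in> B" "K = \<phi> H" by blast
    have "\<phi> ` B - {K} = \<phi> ` (B - {H})"
      using H inj hyp_L BM by blast
    moreover have "\<not> \<Inter>(B - {H}) \<subseteq> H" using B H by (simp add: lattice_independent_def)
    moreover have "B - {H} \<subseteq> M" "H \<in> M" using H BM by auto
    ultimately show "\<not> \<Inter>(\<phi> ` B - {K}) \<subseteq> K" using transfer H by simp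
  qed
  moreover have "\<phi> H \<in> line_closure A (\<phi> ` B)" if "H \<in> line_closure M B" for H
    using that
  proof induction
    case (base H)
    then show ?case by (auto intro: line_closure.base)
  next
    case (step G H K)
    have GH: "G \<in> M" "H \<in> M" using step line_closure_subset[OF BM] by auto
    have "\<phi> G \<inter> \<phi> H \<subseteq> \<phi> K"
      using transfer[of "{G, H}" K] GH step by simp
    moreover have "\<phi> G \<noteq> \<phi> H" using inj hyp_L GH step by blast
    moreover have "\<phi> K \<in> A" using image step by blast
    ultimately show ?case using step.IH line_closure.step by metis
  qed
  then have "A \<subseteq> line_closure A (\<phi> ` B)" using clos image by blast
  moreover have "\<phi> ` B \<subseteq> A" using BM image by blast
  ultimately show ?thesis unfolding line_generated_def by blast
qed

section \<open>The hyperpolygonal arrangement\<close>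

lemma signed_hyperplane_Compl: "signed_hyperplane (UNIV - I) = signed_hyperplane I"
  by (auto simp: signed_hyperplane_def double_diff)

text \<open>In this form, deleting \<open>i\<close> from \<open>I\<close> changes only the left
  side, by \<open>2 * x $ i\<close>.\<close>

lemma signed_hyperplane_iff:
  "x \<in> signed_hyperplane I \<longleftrightarrow> 2 * (\<Sum>i\<in>I. x $ i) = (\<Sum>i\<in>UNIV. x $ i)"
proof -
  have "(\<Sum>i\<in>UNIV. x $ i) = (\<Sum>i\<in>UNIV - I. x $ i) + (\<Sum>i\<in>I. x $ i)"
    by (rule sum.subset_diff) auto
  then show ?thesis by (auto simp: signed_hyperplane_def)
qed

lemma sum_axis: "finite I \<Longrightarrow> (\<Sum>i\<in>I. axis z (a::real) $ i) = (if z \<in> I then a else 0)"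
  by (simp add: axis_def)

lemma line_generated_hyperpolygonal:
  "line_generated (hyperpolygonal :: (real ^ 'n::finite) set set)"
proof -
  fix z :: 'n
  let ?M = "hyperpolygonal :: (real ^ 'n) set set"
  let ?s = "signed_hyperplane :: 'n set \<Rightarrow> _" and ?h = "coordinate_hyperplane :: 'n \<Rightarrow> _"
  define B where "B = insert (?s UNIV) (?h ` (UNIV - {z}))"
  let ?C = "line_closure ?M B"
  have sM: "?s I \<in> ?M" if "I \<noteq> {}" for I using that by (auto simp: hyperpolygonal_def)
  have hM: "?h i \<in> ?M" for i by (auto simp: hyperpolygonal_def)
  have axis_h: "axis j 1 \<in> ?h i \<longleftrightarrow> j \<noteq> i" for i j
    by (auto simp: coordinate_hyperplane_def axis_def)
  have axis_s: "axis j 1 \<notin> ?s I" for j I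
    by (simp add: signed_hyperplane_iff sum_axis)
  have "lattice_independent B"
    unfolding lattice_independent_def
  proof (rule ballI)
    fix H assume H: "H \<in> B"
    show "\<not> \<Inter>(B - {H}) \<subseteq> H"
    proof (cases "H = ?s UNIV")
      case True
      \<comment> \<open>Its only nonzero coordinate is at \<open>z\<close>, and \<open>?h z\<close>
        was left out when forming the coordinate part of \<open>B\<close>.\<close>
      have "axis z 1 \<in> \<Inter>(B - {H})" using True by (auto simp: B_def axis_h)
      then show ?thesis using axis_s True by blast
    next
      case False
      then obtain j where j: "j \<noteq> z" "H = ?h j" using H by (auto simp: B_def)
      \<comment> \<open>Subtracting \<open>axis z 1\<close> makes the coordinate sum zero without
        leaving any \<open>?h i\<close> with \<open>i\<close> distinct from \<open>j\<close> and
        \<open>z\<close>.\<close>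
      let ?x = "axis j 1 - axis z 1 :: real ^ 'n"
      have "?x \<in> ?s UNIV"
        by (simp add: signed_hyperplane_iff sum_subtractf sum_axis)
      moreover have "?x \<in> ?h i" if "i \<noteq> z" "i \<noteq> j" for i
        using that by (auto simp: coordinate_hyperplane_def axis_def)
      ultimately have "?x \<in> \<Inter>(B - {H})" using j by (auto simp: B_def)
      moreover have "?x \<notin> H" using j by (auto simp: coordinate_hyperplane_def axis_def)
      ultimately show ?thesis by blast
    qed
  qed
  \<comment> \<open>The coordinates in \<open>J\<close> are deleted from the full index set one at a
    time; avoiding \<open>z\<close> keeps each \<open>?h j\<close> in \<open>B\<close> and
    \<open>UNIV - J\<close> nonempty.\<close>
  moreover have s_z: "?s (UNIV - J) \<in> ?C" if "z \<notin> J" for J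
    using finite[of J] that
  proof (induction J rule: finite_induct)
    case empty
    then show ?case by (auto simp: B_def intro: line_closure.base)
  next
    case (insert j J)
    have *: "insert j (UNIV - insert j J) = UNIV - J" using insert by blast
    have "(\<Sum>i\<in>UNIV - J. x $ i) = x $ j + (\<Sum>i\<in>UNIV - insert j J. x $ i)" for x :: "real ^ 'n"
      by (subst *[symmetric]) simp
    then have "?s (UNIV - J) \<inter> ?h j \<subseteq> ?s (UNIV - insert j J)"
      by (auto simp: signed_hyperplane_iff coordinate_hyperplane_def)
    moreover have "?h j \<in> ?C" using insert by (auto simp: B_def intro: line_closure.base)
    moreover have "?s (UNIV - J) \<noteq> ?h j" using axis_s axis_h[of z j] insert by blast
    moreover have "?s (UNIV - insert j J) \<in> ?M" using insert by (intro sM) blast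
    ultimately show ?case using insert line_closure.step by (metis insertCI)
  qed
  have s: "?s I \<in> ?C" for I
    \<comment> \<open>If \<open>z \<notin> I\<close>, pass to the complement; the case
      \<open>I = {}\<close> is thus covered by \<open>?s UNIV\<close>.\<close>
    using s_z[of "UNIV - I"] s_z[of I] by (cases "z \<in> I") (auto simp: signed_hyperplane_Compl)
  have "?h z \<in> ?C"
  proof (cases "UNIV = {z}")
    \<comment> \<open>In dimension one \<open>?s UNIV\<close> and \<open>?s {z}\<close> coincide, so
      no closure step applies to them, but \<open>?h z\<close> is already that hyperplane.\<close>
    case True
    then have "UNIV - {z} = {}" by blast
    have "?h z = ?s {z}"
      unfolding signed_hyperplane_def coordinate_hyperplane_def \<open>UNIV - {z} = {}\<close> by simp
    then show ?thesis using s by simp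
  next
    case False
    then obtain w where w: "w \<noteq> z" by blast
    have "axis z 1 - axis w 1 \<in> ?s UNIV" "axis z 1 - axis w 1 \<notin> ?s {z}"
      using w by (simp_all add: signed_hyperplane_iff sum_subtractf sum_axis axis_def)
    then have "?s UNIV \<noteq> ?s {z}" by blast
    \<comment> \<open>On \<open>?s UNIV\<close> the coordinate sum is zero, and then
      \<open>?s {z}\<close> forces \<open>2 * x $ z = 0\<close>.\<close>
    moreover have "?s UNIV \<inter> ?s {z} \<subseteq> ?h z"
      by (auto simp: signed_hyperplane_iff coordinate_hyperplane_def)
    ultimately show ?thesis using s hM line_closure.step by metis
  qed
  then have "?h i \<in> ?C" for i
    by (cases "i = z") (auto simp: B_def intro: line_closure.base)
  then have "?M \<subseteq> ?C" using s by (auto simp: hyperpolygonal_def)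
  moreover have "B \<subseteq> ?M" using sM hM by (auto simp: B_def)
  ultimately show ?thesis unfolding line_generated_def by blast
qed

theorem theorem1p6:
  fixes smul :: "'k::field \<Rightarrow> 'v::ab_group_add \<Rightarrow> 'v"
    and A :: "'v set set"
  assumes "vector_space smul"
    and "central_arrangement smul A"
    and "lattice_isomorphic (intersection_lattice A)
           (intersection_lattice (hyperpolygonal :: (real ^ 'n::finite) set set))"
  shows "formal_arrangement smul A"
proof (rule formal_if_line_generated[OF assms(1,2)])
  show "line_generated A"
    using line_generated_lattice_invariant[OF assms(2) central_arrangement_hyperpolygonal]
      lattice_isomorphic_sym[OF assms(3)] line_generated_hyperpolygonal by blast
qed

end
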